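(* Consider an opinion vector $y\in\mathbb{R}^n$ in an SBC or SBI system with bounds vector $r\in\mathbb{R}^n_{>0}$, with the following properties: (i) the opinion intervals of any two weakly connected components (WCCs) of the proximity digraph $G_r(y)$ are separated from each other by a distance strictly larger than the maximum of the (confidence or influence) bounds $r_i$ of the agents in those two WCCs; and (ii) in the SBC case: for any WCC of $y$'s SBC digraph, with $m$ agents, at least $m-1$ of its agents have confidence bounds larger than the length of that WCC's opinion interval; in the SBI case: for any WCC of $y$'s SBI digraph, at least one of its agents has influence bound larger than the length of that WCC's opinion interval. Then the trajectory of the (SBC, respectively SBI) system with initial opinion vector $y$ converges to an agreement opinion vector in finite time. Moreover, in every WCC of the (SBC, respectively SBI) digraph, at least one node is an out-neighbor of all nodes in that WCC for all $t\ge0$.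
   Context: There are $n$ agents with opinion vector $y\in\mathbb{R}^n$ and a fixed bounds vector $r\in\mathbb{R}^n_{>0}$ (confidence bounds in the SBC case, influence bounds in the SBI case). To $y$ one associates a proximity digraph $G_r(y)$ with nodes $\{1,\dots,n\}$, where the set of out-neighbors of node $i$ is: in the synchronized bounded confidence (SBC) case $\mathcal{N}_i(y)=\{j: |y_i-y_j|\le r_i\}$; in the synchronized bounded influence (SBI) case $\mathcal{N}_i(y)=\{j: |y_i-y_j|\le r_j\}$ (so $i\in\mathcal{N}_i(y)$ always). The adjacency matrix $A(y)\in\mathbb{R}^{n\times n}$ has entries $a_{ij}(y)=1/|\mathcal{N}_i(y)|$ if $j\in\mathcal{N}_i(y)$ and $0$ otherwise. The SBC (resp. SBI) system is $x(t+1)=A(x(t))x(t)$, $t\in\{0,1,2,\dots\}$, with time-$t$ digraph $G_r(x(t))$. A weakly connected component (WCC) of a digraph is a maximal subgraph that is connected when edge directions are ignored. The opinion interval of a subgraph of an SBC or SBI digraph is the closed interval in $\mathbb{R}$ between that subgraph's minimum and maximum opinions. An agreement opinion vector is an opinion vector in which any two agents are either disconnected (in the proximity digraph) or in consensus (have equal opinions). *)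

theory Defs
  imports "Graph_Theory.Digraph_Component" "HOL-Analysis.Analysis"
begin

text \<open>SBC: synchronized bounded confidence; SBI: synchronized bounded influence.\<close>

datatype opinion_model = SBC | SBI

fun out_nbrs :: "opinion_model \<Rightarrow> real ^ 'n \<Rightarrow> real ^ 'n \<Rightarrow> 'n \<Rightarrow> 'n set" where
  "out_nbrs SBC r y i = {j. \<bar>y $ i - y $ j\<bar> \<le> r $ i}"
| "out_nbrs SBI r y i = {j. \<bar>y $ i - y $ j\<bar> \<le> r $ j}"

definition proximity_digraph ::
    "opinion_model \<Rightarrow> real ^ 'n \<Rightarrow> real ^ 'n \<Rightarrow> ('n, 'n \<times> 'n) pre_digraph" where
  "proximity_digraph M r y =
     with_proj \<lparr> pverts = UNIV, parcs = {(i, j). j \<in> out_nbrs M r y i} \<rparr>"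

definition adjacency_matrix ::
    "opinion_model \<Rightarrow> real ^ 'n \<Rightarrow> real ^ 'n \<Rightarrow> real ^ 'n ^ 'n" where
  "adjacency_matrix M r y =
     (\<chi> i j. if j \<in> out_nbrs M r y i then 1 / real (card (out_nbrs M r y i)) else 0)"

primrec trajectory ::
    "opinion_model \<Rightarrow> real ^ 'n \<Rightarrow> real ^ 'n \<Rightarrow> nat \<Rightarrow> real ^ 'n" where
  "trajectory M r y 0 = y"
| "trajectory M r y (Suc t) =
     adjacency_matrix M r (trajectory M r y t) *v trajectory M r y t"

text \<open>
  The qualified name selects connectedness of digraphs (disregarding the direction of arcs, and
  with a nonempty set of vertices), not that of topological spaces.
\<close>

definition is_wcc :: "('a, 'b) pre_digraph \<Rightarrow> ('a, 'b) pre_digraph \<Rightarrow> bool" where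
  "is_wcc G C \<longleftrightarrow> pre_digraph.max_subgraph G Digraph_Component.connected C"

definition opinion_interval :: "real ^ 'n \<Rightarrow> ('n, 'b) pre_digraph \<Rightarrow> real set" where
  "opinion_interval y C = {Min ((\<lambda>i. y $ i) ` verts C) .. Max ((\<lambda>i. y $ i) ` verts C)}"

definition opinion_length :: "real ^ 'n \<Rightarrow> ('n, 'b) pre_digraph \<Rightarrow> real" where
  "opinion_length y C = Max ((\<lambda>i. y $ i) ` verts C) - Min ((\<lambda>i. y $ i) ` verts C)"

text \<open>Two agents are disconnected if no path joins them when arc directions are ignored.\<close>

definition agreement_vector :: "opinion_model \<Rightarrow> real ^ 'n \<Rightarrow> real ^ 'n \<Rightarrow> bool" where
  "agreement_vector M r y \<longleftrightarrow>
     (\<forall>i j. \<not> i \<rightarrow>\<^sup>*\<^bsub>with_proj (mk_symmetric (proximity_digraph M r y))\<^esub> j \<or> y $ i = y $ j)"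

end

theory Submission
  imports Defs
begin

text \<open>
  Freeze the weakly connected components of the initial digraph and call them clusters. The whole
  argument rests on the fact that the hypotheses are stable: opinions are averaged, so as long as
  agents only listen inside their own cluster, each cluster keeps its opinions in its initial
  opinion interval; and as long as it does so, the gaps between intervals exceed all bounds
  involved, so that agents only listen inside their own cluster (\<open>out_nbr_same_cluster\<close>,
  \<open>confined_step\<close>).

  The second hypothesis gives every cluster a hub, an agent that all members of the cluster,
  itself included, listen to for as long as the opinions stay in the initial interval
  (\<open>common_out_neighbor_exists\<close>). In the influence model it is an agent whose bound
  exceeds the length of the interval. In the confidence model it is the one agent whose bound may
  be small: the others listen to the entire cluster, and this agent listens to itself. Thus both
  models are covered by the same argument from here on.

  The hub has weight at least \<open>1 / n\<close> in every average, so each step pulls all opinions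
  of the cluster towards that of the hub and shrinks the spread at least by the factor
  \<open>1 - 1 / n\<close> (\<open>spread_step\<close>). After finitely many steps the spread is below the
  smallest bound. Then each agent averages over its entire cluster, so one further step makes the
  opinions constant on every cluster, and nothing moves afterwards
  (\<open>finite_time_convergence\<close>). Later digraphs have no arcs between clusters, hence the
  limit is an agreement vector; and every component of a later digraph lies inside a cluster and,
  because all its nodes have an arc to the hub, contains the hub
  (\<open>wcc_has_common_out_neighbor\<close>).
\<close>

section \<open>Weakly connected components\<close>

abbreviation weakly_reaches :: "('a, 'b) pre_digraph \<Rightarrow> 'a \<Rightarrow> 'a \<Rightarrow> bool" where
  "weakly_reaches G u v \<equiv> u \<rightarrow>\<^sup>*\<^bsub>with_proj (mk_symmetric G)\<^esub> v"

text \<open>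
  The set of nodes that \<open>v\<close> reaches when directions are ignored induces the only weakly
  connected component that contains \<open>v\<close>, as the lemmas below show. Assigning this
  component to \<open>v\<close> turns the partition into components into a function on nodes.
\<close>

definition wcc_of :: "('a, 'b) pre_digraph \<Rightarrow> 'a \<Rightarrow> ('a, 'b) pre_digraph" where
  "wcc_of G v = G \<restriction> {u. weakly_reaches G v u}"

lemma weakly_reaches_sym: "weakly_reaches G u v \<Longrightarrow> weakly_reaches G v u"
  by (rule symmetric_reachable[OF symmetric_mk_symmetric])

lemma verts_wcc_of: "verts (wcc_of G v) = {u. weakly_reaches G v u}"
  by (simp add: wcc_of_def)

context wf_digraph
begin

lemma weakly_reaches_trans:
  "weakly_reaches G u v \<Longrightarrow> weakly_reaches G v w \<Longrightarrow> weakly_reaches G u w"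
proof -
  interpret S: pair_wf_digraph "mk_symmetric G" ..
  show "weakly_reaches G u v \<Longrightarrow> weakly_reaches G v w \<Longrightarrow> weakly_reaches G u w"
    by (rule S.reachable_trans)
qed

lemma weakly_reaches_in_verts: "weakly_reaches G u v \<Longrightarrow> u \<in> verts G \<and> v \<in> verts G"
proof -
  interpret S: pair_wf_digraph "mk_symmetric G" ..
  show "weakly_reaches G u v \<Longrightarrow> u \<in> verts G \<and> v \<in> verts G"
    using S.reachable_in_verts by fastforce
qed

lemma weakly_reaches_arc:
  assumes "e \<in> arcs G" shows "weakly_reaches G (tail G e) (head G e)"
  using assms by (intro reachable_mk_symmetricI reachable_adjI) (rule in_arcs_imp_in_arcs_ends)

lemma self_in_wcc_of: "v \<in> verts G \<Longrightarrow> v \<in> verts (wcc_of G v)"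
  unfolding verts_wcc_of by (auto intro: reachable_mk_symmetricI)

lemma subgraph_wcc_of: "subgraph (wcc_of G v) G"
  unfolding wcc_of_def subgraph_def compatible_def
  using weakly_reaches_in_verts wellformed_induce_subgraph wf_digraph_axioms by auto

text \<open>
  A path between nodes of the component never leaves it, since every node on the path is itself
  reached from \<open>v\<close>; so the induced subgraph retains all the arcs needed.
\<close>

lemma connected_wcc_of:
  assumes "v \<in> verts G"
  shows "Digraph_Component.connected (wcc_of G v)"
proof -
  let ?C = "wcc_of G v"
  interpret C: wf_digraph ?C
    using subgraph_wcc_of by (rule subgraphE)
  interpret S: pair_wf_digraph "mk_symmetric G" ..
  have reach: "weakly_reaches ?C v u" if "weakly_reaches G v u" for u
    using that
  proof (induction rule: S.reachable_induct)
    case base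
    show ?case
      by (rule C.reachable_mk_symmetricI, rule C.reachable_refl, rule self_in_wcc_of, rule assms)
  next
    case (step x y)
    from step.hyps(2) obtain e where e: "e \<in> arcs G"
      and xy: "(x, y) = (tail G e, head G e) \<or> (x, y) = (head G e, tail G e)"
      by (auto simp: parcs_mk_symmetric)
    from xy have "weakly_reaches G x y"
      using weakly_reaches_arc[OF e] weakly_reaches_sym by (metis prod.inject)
    then have "weakly_reaches G v x" "weakly_reaches G v y"
      using step.hyps(1) weakly_reaches_trans by blast+
    then have "e \<in> arcs ?C" using e xy by (auto simp: wcc_of_def)
    then have "weakly_reaches ?C (tail G e) (head G e)"
      using C.weakly_reaches_arc[of e] by (simp add: wcc_of_def)
    then have "weakly_reaches ?C x y"
      using xy weakly_reaches_sym by (metis prod.inject)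
    with step.IH show ?case by (rule C.weakly_reaches_trans)
  qed
  show ?thesis
    unfolding Digraph_Component.connected_def
  proof (rule strongly_connectedI)
    show "verts (with_proj (mk_symmetric ?C)) \<noteq> {}"
      using self_in_wcc_of[OF assms] by auto
    fix a b
    assume "a \<in> verts (with_proj (mk_symmetric ?C))" "b \<in> verts (with_proj (mk_symmetric ?C))"
    then have "weakly_reaches ?C v a" "weakly_reaches ?C v b"
      using reach by (auto simp: verts_wcc_of)
    then show "weakly_reaches ?C a b"
      by (rule C.weakly_reaches_trans[OF weakly_reaches_sym])
  qed
qed

text \<open>
  This makes \<open>wcc_of G v\<close> the greatest, and not merely a maximal, connected subgraph
  around \<open>v\<close>, which is what yields uniqueness of the component.
\<close>

lemma connected_subgraph_le_wcc_of:
  assumes H: "subgraph H G" "Digraph_Component.connected H" and v: "v \<in> verts H"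
  shows "subgraph H (wcc_of G v)"
proof -
  have comp: "compatible G H" and wf: "wf_digraph H" using H(1) by auto
  have "weakly_reaches H v u" if "u \<in> verts H" for u
    using H(2) v that unfolding Digraph_Component.connected_def strongly_connected_def by simp
  then have vs: "verts H \<subseteq> verts (wcc_of G v)"
    unfolding verts_wcc_of
    using pre_digraph.reachable_mono[OF _ subgraph_mk_symmetric[OF H(1)]] by blast
  moreover have "arcs H \<subseteq> arcs (wcc_of G v)"
  proof
    fix e assume e: "e \<in> arcs H"
    then have "tail G e \<in> verts H" "head G e \<in> verts H" "e \<in> arcs G"
      using wf_digraph.wellformed[OF wf e] H(1) compatible_tail[OF comp] compatible_head[OF comp]
      by auto
    then show "e \<in> arcs (wcc_of G v)"
      using vs unfolding verts_wcc_of by (auto simp: wcc_of_def)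
  qed
  moreover have "compatible (wcc_of G v) H"
    using comp by (simp add: compatible_def wcc_of_def)
  ultimately show ?thesis
    using wf subgraph_wcc_of[of v] by (auto intro: subgraphI)
qed

lemma subgraph_antisym:
  fixes H K :: "('x, 'y) pre_digraph"
  shows "subgraph H K \<Longrightarrow> subgraph K H \<Longrightarrow> H = K"
  by (auto simp: subgraph_def compatible_def)

lemma is_wcc_wcc_of:
  assumes "v \<in> verts G" shows "is_wcc G (wcc_of G v)"
  unfolding is_wcc_def max_subgraph_def
proof (intro conjI allI impI notI; (elim conjE)?)
  show "subgraph (wcc_of G v) G" by (rule subgraph_wcc_of)
  show "Digraph_Component.connected (wcc_of G v)" using assms by (rule connected_wcc_of)
  fix H assume H: "H \<noteq> wcc_of G v" "subgraph (wcc_of G v) H" "subgraph H G"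
    "Digraph_Component.connected H"
  have "v \<in> verts H" using self_in_wcc_of[OF assms] H(2) by auto
  then have "subgraph H (wcc_of G v)" by (rule connected_subgraph_le_wcc_of[OF H(3,4)])
  with H(1,2) show False using subgraph_antisym by blast
qed

lemma wcc_eq_wcc_of:
  assumes C: "is_wcc G C" and v: "v \<in> verts C" shows "C = wcc_of G v"
proof -
  have C': "subgraph C G" "Digraph_Component.connected C"
    using C by (auto simp: is_wcc_def max_subgraph_def)
  then have "v \<in> verts G" using v by auto
  then show ?thesis
    using C connected_subgraph_le_wcc_of[OF C' v] subgraph_wcc_of[of v] connected_wcc_of[of v]
    unfolding is_wcc_def max_subgraph_def by metis
qed

lemma wcc_verts_nonempty: "is_wcc G C \<Longrightarrow> verts C \<noteq> {}"
  by (auto simp: is_wcc_def max_subgraph_def Digraph_Component.connected_def strongly_connected_def)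

end

section \<open>Averages in which one element has guaranteed weight\<close>

text \<open>
  The summand \<open>f k\<close> has weight \<open>1 / card S \<ge> 1 / n\<close>, and its excess over the
  lower bound \<open>a\<close> contributes accordingly, while the other excesses are nonnegative. Using
  \<open>n\<close> in place of \<open>card S\<close> makes the bound the same for all agents, although
  they have different numbers of neighbors.
\<close>

lemma average_ge:
  fixes f :: "'a \<Rightarrow> real"
  assumes "finite S" "k \<in> S" "\<And>j. j \<in> S \<Longrightarrow> a \<le> f j" "card S \<le> n"
  shows "a + (f k - a) / real n \<le> sum f S / real (card S)"
proof -
  have card: "0 < card S" using assms(1,2) card_gt_0_iff by blast
  have "f k - a \<le> (\<Sum>j\<in>S. f j - a)"
    using assms(1,2,3) by (intro member_le_sum) auto
  also have "\<dots> = sum f S - real (card S) * a" by (simp add: sum_subtractf)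
  finally have "(f k - a) / real (card S) \<le> (sum f S - real (card S) * a) / real (card S)"
    by (intro divide_right_mono) auto
  moreover have "(f k - a) / real n \<le> (f k - a) / real (card S)"
    using assms(2,3,4) card by (intro divide_left_mono) auto
  moreover have "(sum f S - real (card S) * a) / real (card S) = sum f S / real (card S) - a"
    using card by (simp add: field_simps)
  ultimately show ?thesis by linarith
qed

lemma average_le:
  fixes f :: "'a \<Rightarrow> real"
  assumes "finite S" "k \<in> S" "\<And>j. j \<in> S \<Longrightarrow> f j \<le> b" "card S \<le> n"
  shows "sum f S / real (card S) \<le> b - (b - f k) / real n"
proof -
  have "- b + (- f k - - b) / real n \<le> (\<Sum>j\<in>S. - f j) / real (card S)"
    using assms by (intro average_ge) auto
  moreover have "(- f k - - b) / real n = (b - f k) / real n" by simp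
  ultimately show ?thesis unfolding sum_negf by simp
qed

section \<open>Clusters with a hub\<close>

definition confined :: "('n \<Rightarrow> 'c) \<Rightarrow> ('c \<Rightarrow> real) \<Rightarrow> ('c \<Rightarrow> real) \<Rightarrow> real ^ 'n \<Rightarrow> bool" where
  "confined cluster lo hi x \<longleftrightarrow> (\<forall>i. x $ i \<in> {lo (cluster i)..hi (cluster i)})"

text \<open>
  The spread of a cluster is bounded by an enclosing interval instead of the difference of
  its extreme values: one averaging step transforms the end points of any enclosing interval
  explicitly.
\<close>

definition spread_le :: "('n \<Rightarrow> 'c) \<Rightarrow> real \<Rightarrow> real ^ 'n \<Rightarrow> bool" where
  "spread_le cluster d x \<longleftrightarrow>
     (\<forall>i. \<exists>a b. b - a \<le> d \<and> (\<forall>j. cluster j = cluster i \<longrightarrow> x $ j \<in> {a..b}))"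

definition clusterwise_constant :: "('n \<Rightarrow> 'c) \<Rightarrow> real ^ 'n \<Rightarrow> bool" where
  "clusterwise_constant cluster x \<longleftrightarrow> (\<forall>i j. cluster i = cluster j \<longrightarrow> x $ i = x $ j)"

lemma step_eq_average:
  "(adjacency_matrix M r x *v x) $ i =
     (\<Sum>j\<in>out_nbrs M r x i. x $ j) / real (card (out_nbrs M r x i))"
proof -
  let ?N = "out_nbrs M r x i"
  have "(adjacency_matrix M r x *v x) $ i =
      (\<Sum>j\<in>UNIV. (if j \<in> ?N then 1 / real (card ?N) else 0) * x $ j)"
    unfolding adjacency_matrix_def matrix_vector_mult_def by simp
  also have "\<dots> = (\<Sum>j\<in>?N. x $ j / real (card ?N))"
    by (rule sum.mono_neutral_cong_right) auto
  finally show ?thesis by (simp only: sum_divide_distrib)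
qed

lemma arcs_proximity_digraph:
  "arcs (proximity_digraph M r x) = {(i, j). j \<in> out_nbrs M r x i}"
  by (simp add: proximity_digraph_def)

lemma proximity_digraph_simps [simp]:
  "verts (proximity_digraph M r x) = UNIV"
  "tail (proximity_digraph M r x) = fst"
  "head (proximity_digraph M r x) = snd"
  by (simp_all add: proximity_digraph_def)

lemma wf_digraph_proximity_digraph: "wf_digraph (proximity_digraph M r x)"
  by unfold_locales simp_all

text \<open>
  All that the dynamics needs to know about the initial components. The bound on the distance
  of clusters and the existence of hubs are required for all confined opinion vectors rather than
  only for the initial one, so that they remain available along the whole trajectory.
\<close>

locale hub_clusters =
  fixes M :: opinion_model and r :: "real ^ 'n"
    and cluster :: "'n \<Rightarrow> 'c" and lo hi :: "'c \<Rightarrow> real" and hub :: "'c \<Rightarrow> 'n"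
  assumes r_pos: "r $ i > 0"
    and separated: "\<lbrakk>cluster i \<noteq> cluster j; u \<in> {lo (cluster i)..hi (cluster i)};
        v \<in> {lo (cluster j)..hi (cluster j)}\<rbrakk> \<Longrightarrow> max (r $ i) (r $ j) < \<bar>u - v\<bar>"
    and cluster_hub: "cluster (hub (cluster i)) = cluster i"
    and hub_seen: "confined cluster lo hi x \<Longrightarrow> hub (cluster i) \<in> out_nbrs M r x i"
begin

lemma out_nbr_same_cluster:
  assumes x: "confined cluster lo hi x" and j: "j \<in> out_nbrs M r x i"
  shows "cluster j = cluster i"
proof (rule ccontr)
  assume "cluster j \<noteq> cluster i"
  then have "max (r $ i) (r $ j) < \<bar>x $ i - x $ j\<bar>"
    using x by (intro separated) (auto simp: confined_def)
  with j show False by (cases M) auto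
qed

text \<open>
  The end points of an interval around a cluster move towards the opinion of the hub by a fraction
  \<open>1 / n\<close> of their distance to it. Confinement, contraction and the invariance of
  clusterwise constant vectors are all instances of this estimate.
\<close>

lemma step_between:
  assumes x: "confined cluster lo hi x"
    and ab: "\<And>j. cluster j = cluster i \<Longrightarrow> x $ j \<in> {a..b}"
  defines "h \<equiv> x $ hub (cluster i)"
  shows "(adjacency_matrix M r x *v x) $ i \<in>
     {a + (h - a) / real CARD('n)..b - (b - h) / real CARD('n)}"
proof -
  have "card (out_nbrs M r x i) \<le> CARD('n)" by (rule card_mono) auto
  moreover have "x $ j \<in> {a..b}" if "j \<in> out_nbrs M r x i" for j
    using ab out_nbr_same_cluster[OF x that] .
  ultimately show ?thesis
    unfolding step_eq_average h_def atLeastAtMost_iff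
    using hub_seen[OF x] by (intro conjI average_ge average_le) auto
qed

lemma confined_step:
  assumes x: "confined cluster lo hi x"
  shows "confined cluster lo hi (adjacency_matrix M r x *v x)"
  unfolding confined_def
proof
  fix i
  let ?h = "x $ hub (cluster i)"
  have in_ival: "x $ j \<in> {lo (cluster i)..hi (cluster i)}" if "cluster j = cluster i" for j
    using x that unfolding confined_def by metis
  have "0 \<le> (?h - lo (cluster i)) / real CARD('n)" "0 \<le> (hi (cluster i) - ?h) / real CARD('n)"
    using in_ival[OF cluster_hub] by auto
  then show "(adjacency_matrix M r x *v x) $ i \<in> {lo (cluster i)..hi (cluster i)}"
    using step_between[OF x in_ival, of i] by auto
qed

text \<open>
  All members of the cluster share the same new interval, because they share the hub; its length
  does not depend on the opinion of the hub.
\<close>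

lemma spread_step:
  assumes x: "confined cluster lo hi x" and d: "spread_le cluster d x"
  shows "spread_le cluster ((1 - 1 / real CARD('n)) * d) (adjacency_matrix M r x *v x)"
  unfolding spread_le_def
proof
  fix i
  let ?n = "real CARD('n)" and ?h = "x $ hub (cluster i)"
  obtain a b where ab: "b - a \<le> d" "\<And>j. cluster j = cluster i \<Longrightarrow> x $ j \<in> {a..b}"
    using d unfolding spread_le_def by metis
  let ?a = "a + (?h - a) / ?n" and ?b = "b - (b - ?h) / ?n"
  have "?n \<ge> 1" by (simp add: Suc_leI)
  then have "0 \<le> 1 - 1 / ?n" by simp
  then have "(1 - 1 / ?n) * (b - a) \<le> (1 - 1 / ?n) * d"
    using ab(1) by (rule mult_left_mono[rotated])
  moreover have "?b - ?a = (1 - 1 / ?n) * (b - a)" by (simp add: field_simps)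
  moreover have "(adjacency_matrix M r x *v x) $ j \<in> {?a..?b}" if "cluster j = cluster i" for j
    using step_between[OF x, of j a b] ab(2) that by simp
  ultimately show "\<exists>a b. b - a \<le> (1 - 1 / ?n) * d \<and> (\<forall>j. cluster j = cluster i \<longrightarrow>
      (adjacency_matrix M r x *v x) $ j \<in> {a..b})"
    by (intro exI[of _ ?a] exI[of _ ?b]) simp
qed

text \<open>
  Below the smallest bound the two models no longer differ: every agent listens exactly to its own
  cluster.
\<close>

lemma out_nbrs_small_spread:
  assumes x: "confined cluster lo hi x" and d: "spread_le cluster d x" and le: "\<And>i. d \<le> r $ i"
  shows "out_nbrs M r x i = {j. cluster j = cluster i}"
proof
  show "out_nbrs M r x i \<subseteq> {j. cluster j = cluster i}"
    using out_nbr_same_cluster[OF x] by blast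
  show "{j. cluster j = cluster i} \<subseteq> out_nbrs M r x i"
  proof
    fix j assume j: "j \<in> {j. cluster j = cluster i}"
    obtain a b where ab: "b - a \<le> d" "\<And>j. cluster j = cluster i \<Longrightarrow> x $ j \<in> {a..b}"
      using d unfolding spread_le_def by metis
    have "\<bar>x $ i - x $ j\<bar> \<le> d" using ab(1) ab(2)[of i] ab(2)[of j] j by auto
    then show "j \<in> out_nbrs M r x i"
      using le[of i] le[of j] by (cases M) auto
  qed
qed

lemma clusterwise_constant_step:
  assumes "confined cluster lo hi x" "spread_le cluster d x" "\<And>i. d \<le> r $ i"
  shows "clusterwise_constant cluster (adjacency_matrix M r x *v x)"
  unfolding clusterwise_constant_def
proof (intro allI impI)
  fix i j
  assume "cluster i = cluster j"
  then have "out_nbrs M r x i = out_nbrs M r x j"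
    unfolding out_nbrs_small_spread[OF assms] by simp
  then show "(adjacency_matrix M r x *v x) $ i = (adjacency_matrix M r x *v x) $ j"
    by (simp only: step_eq_average)
qed

lemma step_fixes_constant:
  assumes x: "confined cluster lo hi x" and c: "clusterwise_constant cluster x"
  shows "adjacency_matrix M r x *v x = x"
  unfolding vec_eq_iff
proof
  fix i
  have eq: "x $ j \<in> {x $ i..x $ i}" if "cluster j = cluster i" for j
  proof -
    from c that have "x $ j = x $ i" unfolding clusterwise_constant_def by blast
    then show ?thesis by simp
  qed
  let ?h = "x $ hub (cluster i)"
  \<comment> \<open>The constant vector is enclosed by a degenerate interval, which a step cannot move.\<close>
  have "(adjacency_matrix M r x *v x) $ i \<in>
      {x $ i + (?h - x $ i) / real CARD('n)..x $ i - (x $ i - ?h) / real CARD('n)}"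
    by (rule step_between[OF x]) (rule eq)
  moreover have "?h = x $ i" using eq[OF cluster_hub] by simp
  ultimately show "(adjacency_matrix M r x *v x) $ i = x $ i" by simp
qed

lemma confined_trajectory:
  "confined cluster lo hi y \<Longrightarrow> confined cluster lo hi (trajectory M r y t)"
  by (induction t) (auto intro: confined_step)

lemma spread_trajectory:
  assumes "confined cluster lo hi y" "spread_le cluster d y"
  shows "spread_le cluster ((1 - 1 / real CARD('n)) ^ t * d) (trajectory M r y t)"
proof (induction t)
  case (Suc t)
  then show ?case
    using spread_step[OF confined_trajectory[OF assms(1)] Suc.IH] by (simp add: mult.assoc)
qed (use assms in simp)

lemma spread_le_of_confined:
  assumes "confined cluster lo hi y"
  shows "spread_le cluster (Max (range (\<lambda>i. hi (cluster i) - lo (cluster i)))) y"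
  unfolding spread_le_def
proof
  fix i
  have "hi (cluster i) - lo (cluster i) \<le> Max (range (\<lambda>i. hi (cluster i) - lo (cluster i)))"
    by (rule Max_ge) auto
  moreover have "y $ j \<in> {lo (cluster i)..hi (cluster i)}" if "cluster j = cluster i" for j
    using assms that unfolding confined_def by metis
  ultimately show "\<exists>a b. b - a \<le> Max (range (\<lambda>i. hi (cluster i) - lo (cluster i))) \<and>
      (\<forall>j. cluster j = cluster i \<longrightarrow> y $ j \<in> {a..b})"
    by (intro exI[of _ "lo (cluster i)"] exI[of _ "hi (cluster i)"]) simp
qed

text \<open>
  The spread decreases geometrically, and the smallest of the finitely many positive bounds is
  still positive.
\<close>

lemma eventually_small_spread:
  assumes y: "confined cluster lo hi y"
  obtains t d where "spread_le cluster d (trajectory M r y t)" "\<And>i. d \<le> r $ i"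
proof -
  let ?q = "1 - 1 / real CARD('n)" and ?rmin = "Min (range (($) r))"
  obtain d where d: "spread_le cluster d y" using spread_le_of_confined[OF y] by blast
  have "real CARD('n) \<ge> 1" by (simp add: Suc_leI)
  then have "norm ?q < 1" by simp
  then have "(\<lambda>t. ?q ^ t) \<longlonglongrightarrow> 0" by (rule LIMSEQ_power_zero)
  then have lim: "(\<lambda>t. ?q ^ t * d) \<longlonglongrightarrow> 0" by (rule tendsto_mult_left_zero)
  have "0 < ?rmin" using r_pos by simp
  with lim have "eventually (\<lambda>t. ?q ^ t * d < ?rmin) sequentially" by (rule order_tendstoD)
  then obtain t where t: "?q ^ t * d < ?rmin" by (auto simp: eventually_sequentially)
  have "?q ^ t * d \<le> r $ i" for i
  proof -
    have "?rmin \<le> r $ i" by (rule Min_le) auto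
    with t show ?thesis by linarith
  qed
  then show thesis using spread_trajectory[OF y d, of t] that by blast
qed

lemma finite_time_convergence:
  assumes y: "confined cluster lo hi y"
  obtains T z where "confined cluster lo hi z" "clusterwise_constant cluster z"
    "\<And>t. t \<ge> T \<Longrightarrow> trajectory M r y t = z"
proof -
  obtain t d where "spread_le cluster d (trajectory M r y t)" "\<And>i. d \<le> r $ i"
    using eventually_small_spread[OF y] by blast
  note const = clusterwise_constant_step[OF confined_trajectory[OF y] this]
  let ?z = "trajectory M r y (Suc t)"
  have z: "confined cluster lo hi ?z" using y by (rule confined_trajectory)
  have "trajectory M r y s = ?z" if "s \<ge> Suc t" for s
    using that
  proof (induction s rule: dec_induct)
    case (step s)
    have "trajectory M r y (Suc s) = adjacency_matrix M r ?z *v ?z"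
      by (subst trajectory.simps(2)) (simp only: step.IH)
    also have "\<dots> = ?z" using const by (intro step_fixes_constant z) simp
    finally show ?case .
  qed simp
  with z const show thesis by (intro that) simp_all
qed

text \<open>
  Every arc stays inside a cluster, whichever its direction. For the limit of a trajectory this
  gives agreement; for the vectors before, it keeps each component inside a single cluster.
\<close>

lemma weakly_reachable_same_cluster:
  assumes x: "confined cluster lo hi x"
    and ij: "weakly_reaches (proximity_digraph M r x) i j"
  shows "cluster i = cluster j"
proof -
  have "(i, j) \<in> (parcs (mk_symmetric (proximity_digraph M r x)))\<^sup>*"
    using ij unfolding reachable_def by (auto dest: rtrancl_on_rtranclI)
  then show ?thesis
  proof (induction rule: rtrancl_induct)
    case (step u v)
    then have "v \<in> out_nbrs M r x u \<or> u \<in> out_nbrs M r x v"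
      by (auto simp: parcs_mk_symmetric proximity_digraph_def)
    then have "cluster u = cluster v" by (auto dest: out_nbr_same_cluster[OF x])
    with step.IH show ?case by simp
  qed simp
qed

lemma agreement_of_clusterwise_constant:
  "\<lbrakk>confined cluster lo hi z; clusterwise_constant cluster z\<rbrakk> \<Longrightarrow> agreement_vector M r z"
  unfolding agreement_vector_def clusterwise_constant_def
  using weakly_reachable_same_cluster by blast

text \<open>
  A component of a confined digraph lies inside one cluster, and the arc from any of its nodes to
  the hub of that cluster puts the hub into the component.
\<close>

lemma wcc_has_common_out_neighbor:
  assumes x: "confined cluster lo hi x" and C: "is_wcc (proximity_digraph M r x) C"
  shows "\<exists>k \<in> verts C. \<forall>i \<in> verts C. k \<in> out_nbrs M r x i"
proof -
  let ?G = "proximity_digraph M r x"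
  interpret G: wf_digraph ?G by (rule wf_digraph_proximity_digraph)
  obtain v where v: "v \<in> verts C" using G.wcc_verts_nonempty[OF C] by blast
  have verts_C: "verts C = {u. weakly_reaches ?G v u}"
    unfolding G.wcc_eq_wcc_of[OF C v] verts_wcc_of ..
  have "hub (cluster v) \<in> verts C"
    using G.weakly_reaches_arc[of "(v, hub (cluster v))"] hub_seen[OF x, of v]
    unfolding verts_C by (simp add: arcs_proximity_digraph)
  moreover have "hub (cluster v) \<in> out_nbrs M r x i" if "i \<in> verts C" for i
  proof -
    have "cluster v = cluster i"
      using that unfolding verts_C by (intro weakly_reachable_same_cluster[OF x]) simp
    then show ?thesis using hub_seen[OF x, of i] by simp
  qed
  ultimately show ?thesis by blast
qed

end

section \<open>Agents with large bounds provide a hub\<close>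

lemma ex_all_others_in:
  assumes "finite V" "V \<noteq> {}" "card {i \<in> V. P i} \<ge> card V - 1"
  shows "\<exists>k \<in> V. \<forall>i \<in> V. i \<noteq> k \<longrightarrow> P i"
proof -
  have "card {i \<in> V. \<not> P i} = card (V - {i \<in> V. P i})" by (rule arg_cong[of _ _ card]) auto
  also have "\<dots> = card V - card {i \<in> V. P i}"
    using assms(1) by (intro card_Diff_subset) auto
  finally have "card {i \<in> V. \<not> P i} \<le> Suc 0" using assms(3) by linarith
  then have "\<And>i j. i \<in> V \<Longrightarrow> j \<in> V \<Longrightarrow> \<not> P i \<Longrightarrow> \<not> P j \<Longrightarrow> i = j"
    using assms(1) card_le_Suc0_iff_eq[of "{i \<in> V. \<not> P i}"] by auto
  with assms(2) show ?thesis by blast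
qed

text \<open>
  The witness \<open>k\<close> is an agent with large influence bound in the influence model, but the
  exceptional agent, possibly with a small confidence bound, in the confidence model. It
  is chosen before the opinion vector \<open>x\<close>, so the same agent serves at all times.
\<close>

lemma common_out_neighbor_exists:
  fixes r :: "real ^ 'n"
  assumes r_pos: "\<And>i. r $ i > 0" and V: "V \<noteq> {}"
    and SBC: "M = SBC \<Longrightarrow> card {i \<in> V. r $ i > len} \<ge> card V - 1"
    and SBI: "M = SBI \<Longrightarrow> \<exists>i \<in> V. r $ i > len"
  shows "\<exists>k \<in> V. \<forall>x. (\<forall>i \<in> V. \<forall>j \<in> V. \<bar>x $ i - x $ j\<bar> \<le> len) \<longrightarrow>
    (\<forall>i \<in> V. k \<in> out_nbrs M r x i)"
proof (cases M)
  case SBC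
  obtain k where k: "k \<in> V" "\<And>i. i \<in> V \<Longrightarrow> i \<noteq> k \<Longrightarrow> r $ i > len"
    using ex_all_others_in[of V "\<lambda>i. r $ i > len"] V assms(3)[OF SBC] by auto
  have "k \<in> out_nbrs M r x i" if "\<forall>i \<in> V. \<forall>j \<in> V. \<bar>x $ i - x $ j\<bar> \<le> len" "i \<in> V" for x i
  proof (cases "i = k")
    case True
    then show ?thesis using r_pos[of k] SBC by simp
  next
    case False
    then have "len < r $ i" "\<bar>x $ i - x $ k\<bar> \<le> len" using that k by auto
    then show ?thesis using SBC by simp
  qed
  with k(1) show ?thesis by blast
next
  case SBI
  obtain k where k: "k \<in> V" "r $ k > len" using assms(4)[OF SBI] by blast
  have "k \<in> out_nbrs M r x i" if "\<forall>i \<in> V. \<forall>j \<in> V. \<bar>x $ i - x $ j\<bar> \<le> len" "i \<in> V" for x i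
  proof -
    have "\<bar>x $ i - x $ k\<bar> \<le> len" using that k(1) by blast
    then show ?thesis using SBI k(2) by simp
  qed
  with k(1) show ?thesis by blast
qed

section \<open>Convergence to agreement in finite time\<close>

theorem proposition4p11:
  fixes M :: opinion_model and r y :: "real ^ 'n"
  assumes r_pos: "\<And>i. r $ i > 0"
    and separated: "\<And>C D. is_wcc (proximity_digraph M r y) C \<Longrightarrow>
        is_wcc (proximity_digraph M r y) D \<Longrightarrow> C \<noteq> D \<Longrightarrow>
        setdist (opinion_interval y C) (opinion_interval y D)
          > Max ((\<lambda>i. r $ i) ` (verts C \<union> verts D))"
    and bounds_SBC: "\<And>C. M = SBC \<Longrightarrow> is_wcc (proximity_digraph M r y) C \<Longrightarrow>
        card {i \<in> verts C. r $ i > opinion_length y C} \<ge> card (verts C) - 1"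
    and bounds_SBI: "\<And>C. M = SBI \<Longrightarrow> is_wcc (proximity_digraph M r y) C \<Longrightarrow>
        \<exists>i \<in> verts C. r $ i > opinion_length y C"
  shows "(\<exists>z. agreement_vector M r z \<and> (\<exists>T. \<forall>t \<ge> T. trajectory M r y t = z)) \<and>
    (\<forall>C. is_wcc (proximity_digraph M r y) C \<longrightarrow>
        (\<exists>k \<in> verts C. \<forall>t. \<forall>i \<in> verts C. k \<in> out_nbrs M r (trajectory M r y t) i)) \<and>
    (\<forall>t C. is_wcc (proximity_digraph M r (trajectory M r y t)) C \<longrightarrow>
        (\<exists>k \<in> verts C. \<forall>i \<in> verts C. k \<in> out_nbrs M r (trajectory M r y t) i))"
proof -
  let ?G = "proximity_digraph M r y"
  let ?cluster = "wcc_of ?G"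
  let ?lo = "\<lambda>C :: ('n, 'n \<times> 'n) pre_digraph. Min ((\<lambda>i. y $ i) ` verts C)"
  let ?hi = "\<lambda>C :: ('n, 'n \<times> 'n) pre_digraph. Max ((\<lambda>i. y $ i) ` verts C)"
  interpret G: wf_digraph ?G by (rule wf_digraph_proximity_digraph)
  have wcc: "is_wcc ?G (?cluster i)" and self: "i \<in> verts (?cluster i)" for i
    by (intro G.is_wcc_wcc_of G.self_in_wcc_of; simp)+
  have cluster_eq: "?cluster i = C" if "is_wcc ?G C" "i \<in> verts C" for i C
    using G.wcc_eq_wcc_of[OF that] by simp
  have close: "\<bar>x $ i - x $ j\<bar> \<le> opinion_length y C"
    if x: "confined ?cluster ?lo ?hi x" and C: "is_wcc ?G C" and ij: "i \<in> verts C" "j \<in> verts C"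
    for x C i j
  proof -
    have "x $ i \<in> {?lo C..?hi C}" "x $ j \<in> {?lo C..?hi C}"
      using x cluster_eq[OF C ij(1)] cluster_eq[OF C ij(2)] unfolding confined_def by metis+
    then show ?thesis unfolding opinion_length_def by auto
  qed
  \<comment> \<open>The hub of a component is chosen for all confined vectors at once, hence for all times.\<close>
  have "\<exists>k \<in> verts C. \<forall>x. confined ?cluster ?lo ?hi x \<longrightarrow>
      (\<forall>i \<in> verts C. k \<in> out_nbrs M r x i)" if C: "is_wcc ?G C" for C
    using common_out_neighbor_exists[OF r_pos G.wcc_verts_nonempty[OF C], where M = M,
        OF bounds_SBC[OF _ C] bounds_SBI[OF _ C]] close[OF _ C]
    by meson
  then obtain hub where hub: "\<And>C. is_wcc ?G C \<Longrightarrow> hub C \<in> verts C"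
    "\<And>C x i. is_wcc ?G C \<Longrightarrow> confined ?cluster ?lo ?hi x \<Longrightarrow> i \<in> verts C \<Longrightarrow>
      hub C \<in> out_nbrs M r x i"
    by metis
  interpret hub_clusters M r ?cluster ?lo ?hi hub
  proof
    fix i show "r $ i > 0" by (rule r_pos)
  next
    fix i j u v
    let ?C = "?cluster i" and ?D = "?cluster j"
    assume ne: "?C \<noteq> ?D" and u: "u \<in> {?lo ?C..?hi ?C}" and v: "v \<in> {?lo ?D..?hi ?D}"
    let ?R = "(\<lambda>i. r $ i) ` (verts ?C \<union> verts ?D)"
    have "r $ i \<le> Max ?R" "r $ j \<le> Max ?R" using self by (auto intro!: Max_ge)
    moreover have "Max ?R < setdist (opinion_interval y ?C) (opinion_interval y ?D)"
      using ne by (intro separated wcc)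
    moreover have "\<dots> \<le> dist u v"
      using u v by (intro setdist_le_dist) (auto simp: opinion_interval_def)
    ultimately show "max (r $ i) (r $ j) < \<bar>u - v\<bar>" by (simp add: dist_real_def)
  next
    fix i show "?cluster (hub (?cluster i)) = ?cluster i"
      by (rule cluster_eq[OF wcc hub(1)[OF wcc]])
  next
    fix x i assume "confined ?cluster ?lo ?hi x"
    then show "hub (?cluster i) \<in> out_nbrs M r x i" by (rule hub(2)[OF wcc _ self])
  qed
  have "y $ i \<in> {?lo (?cluster i)..?hi (?cluster i)}" for i using self[of i] by simp
  then have y: "confined ?cluster ?lo ?hi y" unfolding confined_def by blast
  note traj = confined_trajectory[OF y]
  obtain T z where z: "confined ?cluster ?lo ?hi z" "clusterwise_constant ?cluster z"
    "\<And>t. t \<ge> T \<Longrightarrow> trajectory M r y t = z"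
    using finite_time_convergence[OF y] by blast
  have "\<exists>z. agreement_vector M r z \<and> (\<exists>T. \<forall>t \<ge> T. trajectory M r y t = z)"
    using agreement_of_clusterwise_constant[OF z(1,2)] z(3) by blast
  moreover have "\<exists>k \<in> verts C. \<forall>t. \<forall>i \<in> verts C. k \<in> out_nbrs M r (trajectory M r y t) i"
    if "is_wcc ?G C" for C
    using hub(1)[OF that] hub(2)[OF that traj] by blast
  moreover note wcc_has_common_out_neighbor[OF traj]
  ultimately show ?thesis by blast
qed

end
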